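(* Let $R=k[x_1,\ldots,x_n]$ with $k$ a field, and let $Q$ be a primary monomial ideal of $R$, so that $G(Q)=\{x_{i_1}^{a_1},\ldots,x_{i_r}^{a_r},f_1,\ldots,f_t\}$ where $a_1,\ldots,a_r\in\mathbb{N}$, $1\le i_1<i_2<\cdots<i_r\le n$, and $f_1,\ldots,f_t$ are monomials in $k[x_{i_1},\ldots,x_{i_r}]$. Choose $s\in\{1,\ldots,r\}$ such that $a_s=\max_{1\le j\le r}\{a_j\}$. (1) If there are no generators $f_1,\ldots,f_t$ (i.e. $Q=(x_{i_1}^{a_1},\ldots,x_{i_r}^{a_r})$), then $\omega(Q^m)=(m-1)a_s+\omega(Q)$ for each $m\in\mathbb{N}$. (2) $Q$ is $\omega$-linear if and only if $\omega(Q)=a_s$.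
   Context: $\mathbb{N}=\{1,2,\ldots\}$. For $N\in\mathbb{N}$, an ideal $I$ of a commutative ring $R$ with unity is $N$-absorbing if whenever $f_1,\ldots,f_{N+1}\in R$ satisfy $f_1\cdots f_{N+1}\in I$, there is some $j$ such that the product of the $f_i$ with $i\ne j$ lies in $I$. $\omega(I)$ is the least $N\in\mathbb{N}$ for which $I$ is $N$-absorbing, or $\infty$ if there is none; by convention $\omega(R)=0$. An ideal $I$ is $\omega$-linear if $\omega(I^m)=m\,\omega(I)$ for each $m\in\mathbb{N}$. A monomial ideal of $k[x_1,\ldots,x_n]$ is an ideal generated by monomials; for a monomial ideal $I$, $G(I)$ denotes the set of monomials in $I$ that are minimal with respect to divisibility (the unique minimal monomial generating set). *)

theory Defs
  imports Complex_Main "HOL-Library.Poly_Mapping" "HOL-Library.Extended_Nat"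
begin

text \<open>
  Ideals of a commutative ring are its submodules when it is viewed as a module over itself:
  \<open>ideal.subspace I\<close> says that \<open>I\<close> is an ideal, and \<open>ideal.span S\<close> is the ideal generated
  by \<open>S\<close>.
\<close>

global_interpretation ideal: module "(*) :: 'a::comm_ring_1 \<Rightarrow> 'a \<Rightarrow> 'a"
  by unfold_locales (simp_all add: algebra_simps)

definition ideal_prod :: "'a::comm_ring_1 set \<Rightarrow> 'a set \<Rightarrow> 'a set" where
  "ideal_prod I J = ideal.span {f * g | f g. f \<in> I \<and> g \<in> J}"

primrec ideal_power :: "'a::comm_ring_1 set \<Rightarrow> nat \<Rightarrow> 'a set" where
  "ideal_power I 0 = UNIV"
| "ideal_power I (Suc m) = ideal_prod I (ideal_power I m)"

definition primary_ideal :: "'a::comm_ring_1 set \<Rightarrow> bool" where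
  "primary_ideal I \<longleftrightarrow> ideal.subspace I \<and> I \<noteq> UNIV \<and>
     (\<forall>f g. f * g \<in> I \<longrightarrow> f \<in> I \<or> (\<exists>m\<ge>1. g ^ m \<in> I))"

definition absorbing :: "nat \<Rightarrow> 'a::comm_ring_1 set \<Rightarrow> bool" where
  "absorbing N I \<longleftrightarrow>
     (\<forall>f :: nat \<Rightarrow> 'a. (\<Prod>i\<in>{1..N+1}. f i) \<in> I \<longrightarrow>
        (\<exists>j\<in>{1..N+1}. (\<Prod>i\<in>{1..N+1} - {j}. f i) \<in> I))"

definition omega :: "'a::comm_ring_1 set \<Rightarrow> enat" where
  "omega I =
     (if I = UNIV then 0
      else if \<exists>N\<ge>1. absorbing N I then enat (LEAST N. 1 \<le> N \<and> absorbing N I)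
      else \<infinity>)"

definition omega_linear :: "'a::comm_ring_1 set \<Rightarrow> bool" where
  "omega_linear I \<longleftrightarrow> (\<forall>m\<ge>1. omega (ideal_power I m) = enat m * omega I)"

text \<open>
  Polynomials over \<open>'k\<close> in the variables indexed by \<open>'n\<close>: finitely supported maps from
  exponent vectors to coefficients. For a finite linearly ordered \<open>'n\<close> with \<open>n\<close> elements this
  is the polynomial ring in \<open>n\<close> ordered variables.
\<close>

type_synonym ('n, 'k) mpoly = "('n \<Rightarrow>\<^sub>0 nat) \<Rightarrow>\<^sub>0 'k"

definition Var :: "'n \<Rightarrow> ('n, 'k::comm_ring_1) mpoly" where
  "Var i = Poly_Mapping.single (Poly_Mapping.single i 1) 1"

definition monomials :: "('n, 'k::comm_ring_1) mpoly set" where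
  "monomials = range (\<lambda>e. Poly_Mapping.single e 1)"

definition polys_in :: "'n set \<Rightarrow> ('n, 'k::comm_ring_1) mpoly set" where
  "polys_in V = {p. \<forall>e \<in> Poly_Mapping.keys p. Poly_Mapping.keys e \<subseteq> V}"

definition monomial_ideal :: "('n, 'k::comm_ring_1) mpoly set \<Rightarrow> bool" where
  "monomial_ideal I \<longleftrightarrow> (\<exists>M \<subseteq> monomials. I = ideal.span M)"

definition min_gens :: "('n, 'k::comm_ring_1) mpoly set \<Rightarrow> ('n, 'k) mpoly set" where
  "min_gens I = {u \<in> monomials \<inter> I. \<forall>v \<in> monomials \<inter> I. v dvd u \<longrightarrow> v = u}"

end

theory Submission
  imports Defs
begin

text \<open>
  Let \<open>V\<close> be the set of the variables \<open>x\<^sub>v\<close> that have a power in \<open>Q\<close>, let \<open>P\<close> be the prime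
  ideal that they generate, and let \<open>x\<^sub>v^(A v)\<close> be the pure powers among the generators, with
  largest exponent \<open>c = A w\<close>. A monomial ideal is determined by the set \<open>U\<close> of the exponents of its
  monomials, and for \<open>Q\<close> and all its powers membership in that set depends only on the exponents of
  the variables in \<open>V\<close>.

  The key fact (\<open>omega_mono_ideal\<close>) is that \<open>\<omega>(I)\<close> is the nilpotency index of \<open>P\<close> modulo \<open>I\<close>, the
  least \<open>N\<close> with \<open>P^N \<subseteq> I\<close>, for every such proper ideal \<open>I\<close> that contains a
  power of \<open>P\<close>. If \<open>P^N \<subseteq> I\<close> and a product of \<open>N + 1\<close> factors lies in \<open>I\<close>, then a factor outside \<open>P\<close> can be cancelled
  (\<open>mono_ideal_cancel\<close>), and if all factors lie in \<open>P\<close>, then any \<open>N\<close> of them have their product in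
  \<open>P^N\<close>. If \<open>N = n + 1\<close> is least, then some monomial \<open>y\<^sub>1 \<dots> y\<^sub>n\<close> of degree \<open>n\<close>, with all
  \<open>y\<^sub>l\<close> in \<open>V\<close>, is not in \<open>I\<close>. Then the \<open>n + 1\<close> factors \<open>y\<^sub>1, \<dots>, y\<^sub>n\<close> and \<open>\<Sum>v\<in>V. x\<^sub>v\<close> refute
  that \<open>I\<close> is \<open>n\<close>-absorbing: whichever factor is omitted, the product still contains the term
  \<open>y\<^sub>1 \<dots> y\<^sub>n\<close>, and a monomial ideal contains all terms of its elements.

  What remains is counting degrees. Put \<open>D = (\<Sum>v\<in>V. A v - 1)\<close> and let \<open>N m\<close> be the index of \<open>Q^m\<close>.
  A monomial of degree greater than \<open>D\<close> is divisible by some \<open>x\<^sub>v^(A v)\<close>; splitting off such powers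
  one at a time, at a cost of at most \<open>c\<close> in degree each, gives \<open>N m \<le> (m - 1) c + D + 1\<close>
  (\<open>sumset_power_ge\<close>). Powers of \<open>x\<^sub>w\<close> show \<open>m c \<le> N m\<close> (\<open>sumset_power_on_axis\<close>).

  If \<open>Q\<close> is generated by pure powers, then the upper bound is attained, because a monomial lies in
  \<open>Q^m\<close> only if the integer parts of its exponents divided by \<open>A v\<close> add up to at least \<open>m\<close>
  (\<open>sumset_power_pure\<close>). This is the first claim. For the second, linearity gives
  \<open>m (N 1) \<le> (m - 1) c + D + 1\<close> for all \<open>m\<close>, which forces \<open>N 1 \<le> c\<close>, hence equality. Conversely, if
  \<open>P^c \<subseteq> Q\<close> then \<open>P^(m c) \<subseteq> Q^m\<close>, so that \<open>N m = m c\<close>.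
\<close>

section \<open>Polynomials and their terms\<close>

definition restrict_terms :: "'a set \<Rightarrow> ('a \<Rightarrow>\<^sub>0 'b::comm_monoid_add) \<Rightarrow> ('a \<Rightarrow>\<^sub>0 'b)" where
  "restrict_terms S p =
     (\<Sum>e\<in>Poly_Mapping.keys p \<inter> S. Poly_Mapping.single e (Poly_Mapping.lookup p e))"

lemma lookup_restrict_terms:
  "Poly_Mapping.lookup (restrict_terms S p) e = (if e \<in> S then Poly_Mapping.lookup p e else 0)"
  by (auto simp: restrict_terms_def lookup_sum lookup_single when_def sum.delta in_keys_iff)

lemma keys_restrict_terms: "Poly_Mapping.keys (restrict_terms S p) = Poly_Mapping.keys p \<inter> S"
  by (auto simp: in_keys_iff lookup_restrict_terms split: if_splits)

lemma sum_terms: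
  "p = (\<Sum>e\<in>Poly_Mapping.keys p. Poly_Mapping.single e (Poly_Mapping.lookup p e))"
proof -
  have "restrict_terms UNIV p = p"
    by (rule poly_mapping_eqI) (simp add: lookup_restrict_terms)
  thus ?thesis by (simp add: restrict_terms_def)
qed

lemma Var_power: "(Var v :: ('n, 'k::comm_ring_1) mpoly) ^ b
    = Poly_Mapping.single (Poly_Mapping.single v b) 1"
  by (induction b) (simp_all add: Var_def mult_single single_add [symmetric])

lemma monomial_eq_iff:
  "(Poly_Mapping.single g 1 :: ('n, 'k::comm_ring_1) mpoly) = Poly_Mapping.single h 1 \<longleftrightarrow> g = h"
  by (metis lookup_single_eq lookup_single_not_eq zero_neq_one)

lemma prod_Var:
  assumes "finite I"
  shows "(\<Prod>l\<in>I. Var (y l) :: ('n, 'k::comm_ring_1) mpoly)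
    = Poly_Mapping.single (\<Sum>l\<in>I. Poly_Mapping.single (y l) 1) 1"
  using assms
proof (induction I rule: finite_induct)
  case (insert l I)
  then show ?case by (simp add: Var_def mult_single)
qed simp

lemma dvd_monomialD:
  fixes h g :: "'n \<Rightarrow>\<^sub>0 nat"
  assumes "(Poly_Mapping.single h 1 :: ('n, 'k::comm_ring_1) mpoly) dvd Poly_Mapping.single g 1"
  obtains d where "g = h + d"
proof -
  obtain q where q: "(Poly_Mapping.single g 1 :: ('n, 'k) mpoly) = Poly_Mapping.single h 1 * q"
    using assms by (auto simp: dvd_def)
  have "g \<in> Poly_Mapping.keys (Poly_Mapping.single g 1 :: ('n, 'k) mpoly)" by simp
  then show thesis
    unfolding q using keys_mult [of "Poly_Mapping.single h 1" q] that by auto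
qed

section \<open>Monomial ideals and the degree in a set of variables\<close>

definition vdeg :: "'n set \<Rightarrow> ('n \<Rightarrow>\<^sub>0 nat) \<Rightarrow> nat" where
  "vdeg V e = (\<Sum>v\<in>V. Poly_Mapping.lookup e v)"

lemma vdeg_0 [simp]: "vdeg V 0 = 0"
  and vdeg_add: "vdeg V (e + d) = vdeg V e + vdeg V d"
  by (simp_all add: vdeg_def lookup_add sum.distrib)

lemma vdeg_single:
  "finite V \<Longrightarrow> vdeg V (Poly_Mapping.single v b) = (if v \<in> V then b else 0)"
  by (simp add: vdeg_def lookup_single when_def sum.delta')

lemma vdeg_pos_iff:
  "finite V \<Longrightarrow> 0 < vdeg V e \<longleftrightarrow> (\<exists>v\<in>V. 0 < Poly_Mapping.lookup e v)"
  unfolding neq0_conv [symmetric] vdeg_def by simp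

text \<open>
  One condition says both that \<open>U\<close> is closed under multiplication of monomials and that membership
  in \<open>U\<close> depends only on the coordinates in \<open>V\<close>. It holds for the exponents of the monomials of an
  ideal that is generated by monomials in the variables of \<open>V\<close>.
\<close>
definition upper_in :: "'n set \<Rightarrow> ('n \<Rightarrow>\<^sub>0 nat) set \<Rightarrow> bool" where
  "upper_in V U \<longleftrightarrow> (\<forall>e\<in>U. \<forall>e'.
     (\<forall>v\<in>V. Poly_Mapping.lookup e v \<le> Poly_Mapping.lookup e' v) \<longrightarrow> e' \<in> U)"

lemma upper_inD:
  "upper_in V U \<Longrightarrow> e \<in> U \<Longrightarrow>
    (\<And>v. v \<in> V \<Longrightarrow> Poly_Mapping.lookup e v \<le> Poly_Mapping.lookup e' v) \<Longrightarrow> e' \<in> U"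
  unfolding upper_in_def by blast

lemma upper_in_add: "upper_in V U \<Longrightarrow> e \<in> U \<Longrightarrow> e + d \<in> U"
  by (erule upper_inD) (auto simp: lookup_add)

lemma upper_in_add': "upper_in V U \<Longrightarrow> e \<in> U \<Longrightarrow> d + e \<in> U"
  by (erule upper_inD) (auto simp: lookup_add)

definition mono_ideal :: "('n \<Rightarrow>\<^sub>0 nat) set \<Rightarrow> ('n, 'k::comm_ring_1) mpoly set" where
  "mono_ideal U = {p. Poly_Mapping.keys p \<subseteq> U}"

lemma single_in_mono_ideal [simp]:
  "(Poly_Mapping.single e 1 :: ('n, 'k::comm_ring_1) mpoly) \<in> mono_ideal U \<longleftrightarrow> e \<in> U"
  by (simp add: mono_ideal_def)

lemma subspace_mono_ideal:
  assumes "upper_in V U"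
  shows "ideal.subspace (mono_ideal U :: ('n, 'k::comm_ring_1) mpoly set)"
proof (rule ideal.subspaceI)
  fix c x :: "('n, 'k) mpoly"
  assume "x \<in> mono_ideal U"
  then show "c * x \<in> mono_ideal U"
    using keys_mult [of c x] upper_in_add' [OF assms] by (fastforce simp: mono_ideal_def)
next
  fix x y :: "('n, 'k) mpoly"
  assume "x \<in> mono_ideal U" "y \<in> mono_ideal U"
  then show "x + y \<in> mono_ideal U"
    using Poly_Mapping.keys_add [of x y] by (auto simp: mono_ideal_def)
qed (simp add: mono_ideal_def)

lemma mono_ideal_subset:
  fixes J :: "('n, 'k::comm_ring_1) mpoly set"
  assumes "ideal.subspace J" and "\<And>e. e \<in> U \<Longrightarrow> Poly_Mapping.single e 1 \<in> J"
  shows "mono_ideal U \<subseteq> J"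
proof
  fix p :: "('n, 'k) mpoly"
  assume p: "p \<in> mono_ideal U"
  have "Poly_Mapping.single e (Poly_Mapping.lookup p e) \<in> J" if "e \<in> Poly_Mapping.keys p" for e
  proof -
    have "Poly_Mapping.single 0 (Poly_Mapping.lookup p e) * Poly_Mapping.single e 1 \<in> J"
      using that p assms(2) by (intro ideal.subspace_scale [OF assms(1)]) (auto simp: mono_ideal_def)
    then show ?thesis by (simp add: mult_single)
  qed
  then show "p \<in> J"
    by (subst sum_terms) (rule ideal.subspace_sum [OF assms(1)])
qed

text \<open>
  The polynomials all of whose terms lie in \<open>Q\<close> form an ideal that contains the monomial
  generators of \<open>Q\<close>, so \<open>Q\<close> contains every term of each of its elements.
\<close>
lemma monomial_ideal_eq_mono_ideal:
  fixes Q :: "('n, 'k::comm_ring_1) mpoly set"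
  assumes "monomial_ideal Q"
  shows "Q = mono_ideal {e. Poly_Mapping.single e 1 \<in> Q}" (is "Q = mono_ideal ?U")
proof
  obtain M where M: "M \<subseteq> monomials" "Q = ideal.span M"
    using assms by (auto simp: monomial_ideal_def)
  have Q: "ideal.subspace Q" by (simp add: M)
  have "upper_in UNIV ?U"
    unfolding upper_in_def
  proof (safe)
    fix e e' :: "'n \<Rightarrow>\<^sub>0 nat"
    assume e: "Poly_Mapping.single e 1 \<in> Q"
      and le: "\<forall>v\<in>UNIV. Poly_Mapping.lookup e v \<le> Poly_Mapping.lookup e' v"
    have "e' = (e' - e) + e"
      by (rule poly_mapping_eqI) (simp add: lookup_add lookup_minus le)
    then have "Poly_Mapping.single e' (1::'k)
        = Poly_Mapping.single (e' - e) 1 * Poly_Mapping.single e 1"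
      by (simp add: mult_single)
    then show "Poly_Mapping.single e' 1 \<in> Q"
      using ideal.subspace_scale [OF Q e] by metis
  qed
  then have "ideal.subspace (mono_ideal ?U :: ('n, 'k) mpoly set)"
    by (rule subspace_mono_ideal)
  moreover have "M \<subseteq> mono_ideal ?U"
  proof
    fix p assume p: "p \<in> M"
    then obtain e where "p = Poly_Mapping.single e 1" using M by (auto simp: monomials_def)
    moreover have "p \<in> Q" using p by (simp add: M ideal.span_base)
    ultimately show "p \<in> mono_ideal ?U" by simp
  qed
  ultimately show "Q \<subseteq> mono_ideal ?U"
    unfolding M by (rule ideal.span_minimal [rotated])
  show "mono_ideal ?U \<subseteq> Q" by (rule mono_ideal_subset [OF Q]) simp
qed

text \<open>
  Divisibility of monomials is well founded: a divisor of least total degree among those in \<open>Q\<close> is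
  minimal, since a proper divisor has smaller degree.
\<close>
lemma min_gen_below:
  fixes Q :: "('n::finite, 'k::comm_ring_1) mpoly set"
  assumes "Poly_Mapping.single e 1 \<in> Q"
  obtains g d where "e = g + d" "Poly_Mapping.single g 1 \<in> min_gens Q"
proof -
  let ?P = "\<lambda>g. Poly_Mapping.single g 1 \<in> Q \<and> (\<exists>d. e = g + d)"
  have "?P e" using assms by (auto intro: exI [of _ 0])
  then obtain g where g: "?P g" and least: "\<And>h. ?P h \<Longrightarrow> vdeg UNIV g \<le> vdeg UNIV h"
    using ex_has_least_nat [of ?P e "vdeg UNIV"] by blast
  have "v = Poly_Mapping.single g 1"
    if v: "v \<in> monomials \<inter> Q" "v dvd Poly_Mapping.single g 1" for v
  proof -
    obtain h where h: "v = Poly_Mapping.single h 1" using v by (auto simp: monomials_def)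
    obtain d where d: "g = h + d" using v(2) dvd_monomialD unfolding h by metis
    have "?P h" using g v h d by (auto simp: add.assoc)
    from least [OF this] have "vdeg UNIV d = 0" by (simp add: d vdeg_add)
    then have "d = 0" by (intro poly_mapping_eqI) (simp add: vdeg_def)
    then show ?thesis using h d by simp
  qed
  then have "Poly_Mapping.single g 1 \<in> min_gens Q"
    using g by (auto simp: min_gens_def monomials_def)
  then show thesis using g that by blast
qed

section \<open>The invariant omega as a nilpotency index\<close>

text \<open>
  The monomials with \<open>N \<le> vdeg V e\<close> are those in \<open>P^N\<close>, where \<open>P\<close> is generated by the variables in
  \<open>V\<close>. Hence this is the least \<open>N\<close> for which \<open>P^N\<close> is contained in the monomial ideal given by \<open>U\<close>,
  provided that such an \<open>N\<close> exists.
\<close>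
definition nil_index :: "'n set \<Rightarrow> ('n \<Rightarrow>\<^sub>0 nat) set \<Rightarrow> nat" where
  "nil_index V U = (LEAST N. \<forall>e. N \<le> vdeg V e \<longrightarrow> e \<in> U)"

lemma nil_index_le: "(\<And>e. N \<le> vdeg V e \<Longrightarrow> e \<in> U) \<Longrightarrow> nil_index V U \<le> N"
  unfolding nil_index_def by (rule Least_le) blast

lemma vdeg_ge_nil_index:
  assumes "\<And>e. N \<le> vdeg V e \<Longrightarrow> e \<in> U" and "nil_index V U \<le> vdeg V e"
  shows "e \<in> U"
proof -
  have "\<exists>N. \<forall>e. N \<le> vdeg V e \<longrightarrow> e \<in> U" using assms(1) by blast
  then have "\<forall>e. nil_index V U \<le> vdeg V e \<longrightarrow> e \<in> U"
    unfolding nil_index_def by (rule LeastI_ex)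
  then show ?thesis using assms(2) by blast
qed

lemma vdeg_less_nil_index:
  assumes "\<And>e. N \<le> vdeg V e \<Longrightarrow> e \<in> U" and "e \<notin> U"
  shows "vdeg V e < nil_index V U"
  using vdeg_ge_nil_index [of N V U e, OF assms(1)] assms(2) not_le by blast

text \<open>
  The hypothesis on \<open>g\<close> says that \<open>g\<close> is not in the ideal \<open>P\<close> generated by the variables in \<open>V\<close>, so
  the lemma is the primary property of the ideal in the form \<open>f g \<in> I\<close>, \<open>g \<notin> P\<close> implies \<open>f \<in> I\<close>.
  The reason is a comparison of lowest forms: among the terms of \<open>f\<close> outside \<open>U\<close> take the
  part \<open>f1\<close> of least degree in \<open>V\<close>, and let \<open>g0\<close> be the part of \<open>g\<close> of degree \<open>0\<close>. Polynomials form a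
  domain, so \<open>f1 * g0\<close> has a term, and no other contribution to \<open>f * g\<close> can cancel it.
\<close>
lemma mono_ideal_cancel:
  fixes f g :: "('n::{finite,linorder}, 'k::idom) mpoly"
  assumes U: "upper_in V U" and fg: "f * g \<in> mono_ideal U"
    and e0: "e0 \<in> Poly_Mapping.keys g" "vdeg V e0 = 0"
  shows "f \<in> mono_ideal U"
proof (rule ccontr)
  assume "f \<notin> mono_ideal U"
  then have "\<exists>e. e \<in> Poly_Mapping.keys f - U" by (auto simp: mono_ideal_def)
  then obtain e1 where e1: "e1 \<in> Poly_Mapping.keys f - U"
    and least: "\<And>e. e \<in> Poly_Mapping.keys f - U \<Longrightarrow> vdeg V e1 \<le> vdeg V e"
    using ex_has_least_nat [of "\<lambda>e. e \<in> Poly_Mapping.keys f - U" _ "vdeg V"] by blast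
  define F where "F = {e. e \<notin> U \<and> vdeg V e = vdeg V e1}"
  define G where "G = {e. vdeg V e = 0}"
  define f1 where "f1 = restrict_terms F f"
  define g0 where "g0 = restrict_terms G g"
  have kf: "Poly_Mapping.keys f1 = Poly_Mapping.keys f \<inter> F"
    and kg: "Poly_Mapping.keys g0 = Poly_Mapping.keys g \<inter> G"
    by (simp_all add: f1_def g0_def keys_restrict_terms)
  have kf': "Poly_Mapping.keys (f - f1) \<subseteq> Poly_Mapping.keys f - F"
    and kg': "Poly_Mapping.keys (g - g0) \<subseteq> Poly_Mapping.keys g - G"
    by (auto simp: f1_def g0_def in_keys_iff lookup_minus lookup_restrict_terms split: if_splits)
  have "f1 \<noteq> 0" "g0 \<noteq> 0" using e1 e0 kf kg by (auto simp: F_def G_def)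
  then have "f1 * g0 \<noteq> 0" by simp
  then obtain c where c: "c \<in> Poly_Mapping.keys (f1 * g0)"
    by (metis ex_in_conv keys_eq_empty)
  then obtain a b where ab: "c = a + b" "a \<in> F" "b \<in> G"
    using keys_mult [of f1 g0] kf kg by auto
  have cdeg: "vdeg V c = vdeg V e1" using ab by (simp add: vdeg_add F_def G_def)
  have "c \<notin> U"
  proof
    assume "c \<in> U"
    have "Poly_Mapping.lookup b v = 0" if "v \<in> V" for v
      using ab(3) that by (auto simp: G_def vdeg_def)
    then have "a \<in> U" using upper_inD [OF U \<open>c \<in> U\<close>] ab(1) by (auto simp: lookup_add)
    then show False using ab(2) by (simp add: F_def)
  qed
  have n1: "c \<notin> Poly_Mapping.keys ((f - f1) * g)"
  proof
    assume "c \<in> Poly_Mapping.keys ((f - f1) * g)"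
    then obtain a' b' where *: "c = a' + b'" "a' \<in> Poly_Mapping.keys f" "a' \<notin> F"
      using keys_mult [of "f - f1" g] kf' by blast
    have "a' \<notin> U" using * upper_in_add [OF U] \<open>c \<notin> U\<close> by blast
    then have "vdeg V e1 < vdeg V a'" using * least [of a'] by (auto simp: F_def)
    then show False using * cdeg by (simp add: vdeg_add)
  qed
  have n2: "c \<notin> Poly_Mapping.keys (f1 * (g - g0))"
  proof
    assume "c \<in> Poly_Mapping.keys (f1 * (g - g0))"
    then obtain a' b' where *: "c = a' + b'" "a' \<in> F" "b' \<notin> G"
      using keys_mult [of f1 "g - g0"] kg' kf by blast
    then show False using cdeg by (auto simp: vdeg_add F_def G_def)
  qed
  have "f * g = f1 * g0 + (f - f1) * g + f1 * (g - g0)" by (simp add: algebra_simps)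
  then have "Poly_Mapping.lookup (f * g) c = Poly_Mapping.lookup (f1 * g0) c"
    using n1 n2 by (simp add: lookup_add in_keys_iff)
  then have "c \<in> Poly_Mapping.keys (f * g)" using c by (simp add: in_keys_iff)
  then show False using fg \<open>c \<notin> U\<close> by (auto simp: mono_ideal_def)
qed

lemma vdeg_keys_prod:
  fixes f :: "'i \<Rightarrow> ('n, 'k::comm_ring_1) mpoly"
  assumes "finite I" and "\<And>l e. l \<in> I \<Longrightarrow> e \<in> Poly_Mapping.keys (f l) \<Longrightarrow> 1 \<le> vdeg V e"
    and "e \<in> Poly_Mapping.keys (\<Prod>l\<in>I. f l)"
  shows "card I \<le> vdeg V e"
  using assms
proof (induction I arbitrary: e rule: finite_induct)
  case (insert l I)
  then have "e \<in> Poly_Mapping.keys (f l * (\<Prod>l\<in>I. f l))" by simp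
  then obtain a b where "e = a + b" "a \<in> Poly_Mapping.keys (f l)"
      "b \<in> Poly_Mapping.keys (\<Prod>l\<in>I. f l)"
    using keys_mult [of "f l"] by blast
  then have "1 \<le> vdeg V a" "card I \<le> vdeg V b" using insert by auto
  then show ?case using insert \<open>e = a + b\<close> by (simp add: vdeg_add)
qed simp

text \<open>
  Either all factors lie in the ideal generated by the variables in \<open>V\<close>, and then any \<open>N\<close> of them
  have a product of degree at least \<open>N\<close>, or the factor \<open>f j\<close> outside it can be cancelled.
\<close>
lemma absorbing_mono_ideal:
  fixes U :: "('n::{finite,linorder} \<Rightarrow>\<^sub>0 nat) set"
  assumes U: "upper_in V U" and N: "\<And>e. N \<le> vdeg V e \<Longrightarrow> e \<in> U"
  shows "absorbing N (mono_ideal U :: ('n, 'k::idom) mpoly set)"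
  unfolding absorbing_def
proof (intro allI impI)
  fix f :: "nat \<Rightarrow> ('n, 'k) mpoly"
  assume prod: "(\<Prod>l\<in>{1..N + 1}. f l) \<in> mono_ideal U"
  show "\<exists>j\<in>{1..N + 1}. (\<Prod>l\<in>{1..N + 1} - {j}. f l) \<in> mono_ideal U"
  proof (cases "\<forall>l\<in>{1..N + 1}. \<forall>e\<in>Poly_Mapping.keys (f l). 1 \<le> vdeg V e")
    case True
    have "e \<in> U" if "e \<in> Poly_Mapping.keys (\<Prod>l\<in>{1..N + 1} - {1}. f l)" for e
    proof (rule N)
      have "card ({1..N + 1} - {1}) \<le> vdeg V e"
        using True by (intro vdeg_keys_prod [OF _ _ that]) auto
      then show "N \<le> vdeg V e" by simp
    qed
    then have "(\<Prod>l\<in>{1..N + 1} - {1}. f l) \<in> mono_ideal U" by (auto simp: mono_ideal_def)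
    then show ?thesis by (intro bexI [of _ 1]) auto
  next
    case False
    then obtain j e where j: "j \<in> {1..N + 1}" "e \<in> Poly_Mapping.keys (f j)" "vdeg V e = 0"
      by (metis less_one not_le)
    have "(\<Prod>l\<in>{1..N + 1} - {j}. f l) * f j \<in> mono_ideal U"
      using prod j(1) by (subst (asm) prod.remove [of _ j]) (auto simp: mult.commute)
    then have "(\<Prod>l\<in>{1..N + 1} - {j}. f l) \<in> mono_ideal U"
      by (rule mono_ideal_cancel [OF U _ j(2,3)])
    then show ?thesis using j(1) by blast
  qed
qed

lemma vdeg_sum_units:
  assumes "finite V" and "y ` {1..n} \<subseteq> V"
  shows "vdeg V (\<Sum>l\<in>{1..n}. Poly_Mapping.single (y l) 1) = n"
  using assms by (induction n) (auto simp: vdeg_add vdeg_single image_subset_iff)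

text \<open>
  A monomial of degree at least \<open>n\<close> in \<open>V\<close> is divisible by a product of \<open>n\<close> variables of \<open>V\<close>. This
  turns a degree bound into actual factors.
\<close>
lemma vdeg_ge_split_units:
  fixes e :: "'n \<Rightarrow>\<^sub>0 nat"
  assumes "finite V" and "n \<le> vdeg V e"
  shows "\<exists>y d. y ` {1..n} \<subseteq> V \<and> e = (\<Sum>l\<in>{1..n}. Poly_Mapping.single (y l) 1) + d"
  using assms(2)
proof (induction n)
  case (Suc n)
  then obtain y d where y: "y ` {1..n} \<subseteq> V"
    and e: "e = (\<Sum>l\<in>{1..n}. Poly_Mapping.single (y l) 1) + d"
    by auto
  have "0 < vdeg V d"
    using Suc.prems vdeg_sum_units [OF assms(1) y] by (simp add: e vdeg_add)
  then obtain v where v: "v \<in> V" "0 < Poly_Mapping.lookup d v"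
    using vdeg_pos_iff [OF assms(1)] by blast
  define d' where "d' = d - Poly_Mapping.single v 1"
  have d: "d = Poly_Mapping.single v 1 + d'"
    using v(2) by (intro poly_mapping_eqI)
      (auto simp: d'_def lookup_add lookup_minus lookup_single when_def)
  have "(\<Sum>l\<in>{1..n}. Poly_Mapping.single ((y(Suc n := v)) l) (1::nat))
      = (\<Sum>l\<in>{1..n}. Poly_Mapping.single (y l) 1)"
    by (rule sum.cong) auto
  then have "e = (\<Sum>l\<in>{1..Suc n}. Poly_Mapping.single ((y(Suc n := v)) l) 1) + d'"
    by (simp add: e d add.assoc)
  moreover have "(y(Suc n := v)) ` {1..Suc n} \<subseteq> V"
    using y v by (auto simp: image_subset_iff)
  ultimately show ?case by blast
qed auto

text \<open>
  The witness consists of the variables \<open>y 1, \<dots>, y n\<close> dividing the monomial \<open>u\<close> together with the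
  sum \<open>S\<close> of all variables in \<open>V\<close>. The summand \<open>y j\<close> of \<open>S\<close> replaces an omitted factor \<open>y j\<close>, and the
  other summands of \<open>S\<close> contribute different monomials, so the term \<open>y 1 \<dots> y n\<close> does not cancel
  in any characteristic.
\<close>
lemma not_absorbing_mono_ideal:
  fixes U :: "('n::finite \<Rightarrow>\<^sub>0 nat) set"
  assumes U: "upper_in V U" and N: "\<And>e. Suc n \<le> vdeg V e \<Longrightarrow> e \<in> U"
    and u: "u \<notin> U" "vdeg V u = n"
  shows "\<not> absorbing n (mono_ideal U :: ('n, 'k::comm_ring_1) mpoly set)"
proof
  assume abs: "absorbing n (mono_ideal U :: ('n, 'k) mpoly set)"
  obtain y d where y: "y ` {1..n} \<subseteq> V"
    and ud: "u = (\<Sum>l\<in>{1..n}. Poly_Mapping.single (y l) 1) + d"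
    using vdeg_ge_split_units [of V n u] u by auto
  define e where "e = (\<Sum>l\<in>{1..n}. Poly_Mapping.single (y l) (1::nat))"
  have e: "e \<notin> U" using u upper_in_add [OF U] by (auto simp: ud e_def)
  define S :: "('n, 'k) mpoly" where "S = (\<Sum>v\<in>V. Var v)"
  define f where "f l = (if l = Suc n then S else Var (y l))" for l
  have keysS: "1 \<le> vdeg V a" if "a \<in> Poly_Mapping.keys S" for a
  proof -
    have "a \<in> (\<Union>v\<in>V. Poly_Mapping.keys (Var v :: ('n, 'k) mpoly))"
      using that Poly_Mapping.keys_sum [of "Var :: 'n \<Rightarrow> ('n, 'k) mpoly" V] unfolding S_def by blast
    then show ?thesis by (auto simp: Var_def vdeg_single)
  qed
  have keys_f: "1 \<le> vdeg V a" if "l \<in> {1..n + 1}" "a \<in> Poly_Mapping.keys (f l)" for l a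
    using that keysS y by (auto simp: f_def Var_def vdeg_single image_subset_iff split: if_splits)
  have "a \<in> U" if "a \<in> Poly_Mapping.keys (\<Prod>l\<in>{1..n + 1}. f l)" for a
    using vdeg_keys_prod [OF _ keys_f that] by (intro N) simp
  then have "(\<Prod>l\<in>{1..n + 1}. f l) \<in> mono_ideal U" by (auto simp: mono_ideal_def)
  then obtain j where j: "j \<in> {1..n + 1}" "(\<Prod>l\<in>{1..n + 1} - {j}. f l) \<in> mono_ideal U"
    using abs by (auto simp: absorbing_def)
  have "e \<in> Poly_Mapping.keys (\<Prod>l\<in>{1..n + 1} - {j}. f l)"
  proof (cases "j = Suc n")
    case True
    have "{1..n + 1} - {j} = {1..n}" using True by auto
    then have "(\<Prod>l\<in>{1..n + 1} - {j}. f l) = (\<Prod>l\<in>{1..n}. Var (y l))"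
      by (auto simp: f_def intro: prod.cong)
    then show ?thesis by (simp add: prod_Var e_def)
  next
    case False
    define d where "d = (\<Sum>l\<in>{1..n} - {j}. Poly_Mapping.single (y l) (1::nat))"
    have jn: "j \<in> {1..n}" using j False by auto
    have ed: "e = d + Poly_Mapping.single (y j) 1"
      using jn unfolding e_def d_def by (subst sum.remove [of _ j]) (auto simp: add.commute)
    have "{1..n + 1} - {j} = insert (Suc n) ({1..n} - {j})" using False by auto
    then have "(\<Prod>l\<in>{1..n + 1} - {j}. f l) = S * (\<Prod>l\<in>{1..n} - {j}. f l)"
      by (simp add: f_def)
    also have "(\<Prod>l\<in>{1..n} - {j}. f l) = (\<Prod>l\<in>{1..n} - {j}. Var (y l))"
      by (rule prod.cong) (auto simp: f_def)
    also have "\<dots> = Poly_Mapping.single d 1" by (simp add: prod_Var d_def)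
    also have "S * Poly_Mapping.single d 1
        = (\<Sum>v\<in>V. Poly_Mapping.single (Poly_Mapping.single v 1 + d) 1)"
      by (simp add: S_def Var_def sum_distrib_right mult_single)
    finally have prod_eq: "(\<Prod>l\<in>{1..n + 1} - {j}. f l)
        = (\<Sum>v\<in>V. Poly_Mapping.single (Poly_Mapping.single v 1 + d) 1)" .
    have unit_eq: "Poly_Mapping.single v (1::nat) = Poly_Mapping.single (y j) 1 \<longleftrightarrow> v = y j" for v
      by (metis lookup_single_eq lookup_single_not_eq zero_neq_one)
    have "Poly_Mapping.lookup (\<Prod>l\<in>{1..n + 1} - {j}. f l) e
        = (\<Sum>v\<in>V. if v = y j then 1 else 0)"
      unfolding prod_eq ed
      by (simp add: lookup_sum lookup_single when_def add.commute [of d] unit_eq del: One_nat_def)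
    also have "\<dots> = 1" using y jn by (auto simp: image_subset_iff)
    finally show ?thesis by (simp add: in_keys_iff)
  qed
  then show False using j e by (auto simp: mono_ideal_def)
qed

text \<open>
  Merging the last two factors turns \<open>N + 2\<close> factors into \<open>N + 1\<close>. If the merged factor is the one that
  may be omitted, then even \<open>N\<close> of the original factors suffice.
\<close>
lemma absorbing_Suc:
  fixes I :: "'a::comm_ring_1 set"
  assumes I: "ideal.subspace I" and N: "1 \<le> N" "absorbing N I"
  shows "absorbing (Suc N) I"
  unfolding absorbing_def
proof (intro allI impI)
  fix f :: "nat \<Rightarrow> 'a"
  assume prod: "(\<Prod>l\<in>{1..Suc N + 1}. f l) \<in> I"
  define g where "g l = (if l = N + 1 then f (N + 1) * f (N + 2) else f l)" for l
  have g: "(\<Prod>l\<in>A. g l) = (\<Prod>l\<in>A. f l)" if "N + 1 \<notin> A" for A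
    using that by (intro prod.cong) (auto simp: g_def)
  have g': "g (N + 1) = f (N + 1) * f (N + 2)" by (simp add: g_def)
  have "(\<Prod>l\<in>{1..N}. g l) = (\<Prod>l\<in>{1..N}. f l)" by (rule g) simp
  moreover have "(\<Prod>l\<in>{1..N + 1}. g l) = (\<Prod>l\<in>{1..N}. g l) * g (N + 1)" by simp
  ultimately have "(\<Prod>l\<in>{1..N + 1}. g l) = (\<Prod>l\<in>{1..N}. f l) * (f (N + 1) * f (N + 2))"
    by (simp only: g')
  also have "\<dots> = (\<Prod>l\<in>{1..Suc N + 1}. f l)"
    by (simp only: prod.cl_ivl_Suc add_2_eq_Suc' Suc_eq_plus1 [symmetric] mult.assoc) simp
  finally have "(\<Prod>l\<in>{1..N + 1}. g l) \<in> I" using prod by (simp only:)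
  then obtain j where j: "j \<in> {1..N + 1}" "(\<Prod>l\<in>{1..N + 1} - {j}. g l) \<in> I"
    using N(2) [unfolded absorbing_def, rule_format, of g] by blast
  show "\<exists>j\<in>{1..Suc N + 1}. (\<Prod>l\<in>{1..Suc N + 1} - {j}. f l) \<in> I"
  proof (cases "j = N + 1")
    case True
    have "{1..N + 1} - {j} = {1..N}" using True by auto
    then have "(\<Prod>l\<in>{1..N}. f l) \<in> I" using j g [of "{1..N}"] by simp
    then have "f (N + 2) * (\<Prod>l\<in>{1..N}. f l) \<in> I" by (rule ideal.subspace_scale [OF I])
    moreover have "{1..Suc N + 1} - {N + 1} = insert (N + 2) {1..N}" by auto
    ultimately show ?thesis by (intro bexI [of _ "N + 1"]) simp_all
  next
    case False
    have *: "{1..N + 1} - {j} = insert (N + 1) ({1..N} - {j})"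
      "{1..Suc N + 1} - {j} = insert (N + 2) (insert (N + 1) ({1..N} - {j}))"
      using False j by auto
    have "(\<Prod>l\<in>{1..N} - {j}. g l) = (\<Prod>l\<in>{1..N} - {j}. f l)" by (rule g) simp
    moreover have "(\<Prod>l\<in>{1..N + 1} - {j}. g l) = g (N + 1) * (\<Prod>l\<in>{1..N} - {j}. g l)"
      unfolding * by simp
    ultimately have "(\<Prod>l\<in>{1..N + 1} - {j}. g l)
        = (f (N + 1) * f (N + 2)) * (\<Prod>l\<in>{1..N} - {j}. f l)"
      by (simp only: g')
    also have "\<dots> = (\<Prod>l\<in>{1..Suc N + 1} - {j}. f l)"
    proof -
      have "(\<Prod>l\<in>insert (N + 2) (insert (N + 1) ({1..N} - {j})). f l)
          = f (N + 2) * (f (N + 1) * (\<Prod>l\<in>{1..N} - {j}. f l))"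
        by simp
      then show ?thesis unfolding * by (simp only: mult_ac)
    qed
    finally have "(\<Prod>l\<in>{1..Suc N + 1} - {j}. f l) = (\<Prod>l\<in>{1..N + 1} - {j}. g l)"
      by (rule sym)
    then show ?thesis using j by (intro bexI [of _ j]) auto
  qed
qed

text \<open>
  The counterexample refutes only that the ideal is \<open>n\<close>-absorbing for \<open>n\<close> one below the index;
  smaller values are excluded because being \<open>n\<close>-absorbing is monotone in \<open>n\<close>.
\<close>
lemma omega_mono_ideal:
  fixes U :: "('n::{finite,linorder} \<Rightarrow>\<^sub>0 nat) set"
  assumes U: "upper_in V U" and B: "\<And>e. B \<le> vdeg V e \<Longrightarrow> e \<in> U" and "0 \<notin> U"
  shows "omega (mono_ideal U :: ('n, 'k::idom) mpoly set) = enat (nil_index V U)"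
proof -
  let ?I = "mono_ideal U :: ('n, 'k) mpoly set" and ?N = "nil_index V U"
  have I: "ideal.subspace ?I" by (rule subspace_mono_ideal [OF U])
  have N: "e \<in> U" if "?N \<le> vdeg V e" for e
    by (rule vdeg_ge_nil_index [OF B that])
  have "1 \<le> ?N" using N [of 0] \<open>0 \<notin> U\<close> by (cases ?N) auto
  have "(1 :: ('n, 'k) mpoly) \<notin> ?I" using \<open>0 \<notin> U\<close> by (simp add: mono_ideal_def)
  then have "?I \<noteq> UNIV" by blast
  have abs: "absorbing ?N ?I" by (rule absorbing_mono_ideal [OF U N])
  have "?N \<le> M" if M: "1 \<le> M" "absorbing M ?I" for M
  proof (rule ccontr)
    assume "\<not> ?N \<le> M"
    then obtain n where n: "?N = Suc n" "M \<le> n" by (cases ?N) auto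
    have "\<not> (\<forall>e. n \<le> vdeg V e \<longrightarrow> e \<in> U)"
      using n(1) nil_index_le [of n V U] by auto
    then obtain u where u: "u \<notin> U" "n \<le> vdeg V u" by auto
    then have "vdeg V u = n" using N [of u] n(1) by force
    then have "\<not> absorbing n ?I"
      using not_absorbing_mono_ideal [OF U _ u(1)] N n(1) by metis
    moreover have "absorbing n ?I"
      using n(2) by (induction n rule: dec_induct) (use M absorbing_Suc [OF I] in auto)
    ultimately show False by blast
  qed
  then have "(LEAST N. 1 \<le> N \<and> absorbing N ?I) = ?N"
    using abs \<open>1 \<le> ?N\<close> by (intro Least_equality) auto
  then show ?thesis
    using \<open>?I \<noteq> UNIV\<close> abs \<open>1 \<le> ?N\<close> by (auto simp: omega_def)
qed

section \<open>Powers of a monomial ideal\<close>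

primrec sumset_power :: "('n \<Rightarrow>\<^sub>0 nat) set \<Rightarrow> nat \<Rightarrow> ('n \<Rightarrow>\<^sub>0 nat) set" where
  "sumset_power U 0 = UNIV"
| "sumset_power U (Suc m) = {e + e' | e e'. e \<in> U \<and> e' \<in> sumset_power U m}"

lemma sumset_power_SucI: "e \<in> U \<Longrightarrow> e' \<in> sumset_power U m \<Longrightarrow> e + e' \<in> sumset_power U (Suc m)"
  by auto

text \<open>
  If \<open>e + e'\<close> is below \<open>x'\<close> on \<open>V\<close>, then \<open>x'\<close> is split into the part \<open>d\<close> that agrees with \<open>e\<close> on \<open>V\<close>
  and vanishes elsewhere, and a remainder that is above \<open>e'\<close> on \<open>V\<close>.
\<close>
lemma upper_in_sumset_power:
  fixes U :: "('n::finite \<Rightarrow>\<^sub>0 nat) set"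
  assumes U: "upper_in V U"
  shows "upper_in V (sumset_power U m)"
proof (induction m)
  case (Suc m)
  show ?case unfolding upper_in_def
  proof (intro ballI allI impI)
    fix x x' :: "'n \<Rightarrow>\<^sub>0 nat"
    assume "x \<in> sumset_power U (Suc m)"
      and le: "\<forall>v\<in>V. Poly_Mapping.lookup x v \<le> Poly_Mapping.lookup x' v"
    then obtain e e' where e: "x = e + e'" "e \<in> U" "e' \<in> sumset_power U m" by auto
    define d where "d = Poly_Mapping.Abs_poly_mapping
      (\<lambda>v. if v \<in> V then Poly_Mapping.lookup e v else 0)"
    have d: "Poly_Mapping.lookup d v = (if v \<in> V then Poly_Mapping.lookup e v else 0)" for v
      unfolding d_def by (subst lookup_Abs_poly_mapping) simp_all
    have dU: "d \<in> U" using upper_inD [OF U e(2)] by (simp add: d)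
    have le': "Poly_Mapping.lookup e v + Poly_Mapping.lookup e' v \<le> Poly_Mapping.lookup x' v"
      if "v \<in> V" for v using le that by (simp add: e lookup_add)
    have x': "x' = d + (x' - d)"
    proof (rule poly_mapping_eqI)
      fix v show "Poly_Mapping.lookup x' v = Poly_Mapping.lookup (d + (x' - d)) v"
        using le' [of v] by (auto simp: lookup_add lookup_minus d)
    qed
    have "Poly_Mapping.lookup e' v \<le> Poly_Mapping.lookup (x' - d) v" if "v \<in> V" for v
      using le' [of v] that by (simp add: lookup_minus d)
    then have "x' - d \<in> sumset_power U m" using upper_inD [OF Suc e(3)] by blast
    then show "x' \<in> sumset_power U (Suc m)"
      using x' sumset_power_SucI [OF dU] by metis
  qed
qed (simp add: upper_in_def)

lemma ideal_power_mono_ideal: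
  fixes U :: "('n::finite \<Rightarrow>\<^sub>0 nat) set"
  assumes U: "upper_in V U"
  shows "ideal_power (mono_ideal U :: ('n, 'k::comm_ring_1) mpoly set) m
    = mono_ideal (sumset_power U m)"
proof (induction m)
  case 0
  show ?case by (simp add: mono_ideal_def)
next
  case (Suc m)
  let ?S = "{f * g | f g :: ('n, 'k) mpoly.
    f \<in> mono_ideal U \<and> g \<in> mono_ideal (sumset_power U m)}"
  have "f * g \<in> mono_ideal (sumset_power U (Suc m))"
    if "f \<in> mono_ideal U" "g \<in> mono_ideal (sumset_power U m)" for f g :: "('n, 'k) mpoly"
    using that keys_mult [of f g] by (fastforce simp: mono_ideal_def)
  then have "ideal.span ?S \<subseteq> mono_ideal (sumset_power U (Suc m))"
    by (intro ideal.span_minimal subspace_mono_ideal [OF upper_in_sumset_power [OF U]]) blast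
  moreover have "mono_ideal (sumset_power U (Suc m)) \<subseteq> ideal.span ?S"
  proof (rule mono_ideal_subset)
    fix x assume "x \<in> sumset_power U (Suc m)"
    then obtain e e' where e: "x = e + e'" "e \<in> U" "e' \<in> sumset_power U m" by auto
    then have "(Poly_Mapping.single x 1 :: ('n, 'k) mpoly)
        = Poly_Mapping.single e 1 * Poly_Mapping.single e' 1" by (simp add: mult_single)
    then have "(Poly_Mapping.single x 1 :: ('n, 'k) mpoly) \<in> ?S"
      using e(2,3) single_in_mono_ideal by blast
    then show "Poly_Mapping.single x 1 \<in> ideal.span ?S" by (rule ideal.span_base)
  qed simp
  ultimately show ?case by (simp add: Suc ideal_prod_def)
qed

text \<open>
  An exponent of degree greater than \<open>\<Sum>v\<in>V. A v - 1\<close> has some coordinate \<open>v\<close> that is at least \<open>A v\<close>.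
  Splitting off this element of \<open>U\<close> lowers the degree by at most \<open>c\<close>. Adding \<open>c\<close> on the right instead
  of writing \<open>(m - 1) * c\<close> on the left lets the induction start at \<open>m = 0\<close>.
\<close>
lemma sumset_power_ge:
  assumes "\<And>v. v \<in> V \<Longrightarrow> Poly_Mapping.single v (A v) \<in> U" and U: "upper_in V U"
    and V: "finite V" and c: "\<And>v. v \<in> V \<Longrightarrow> 1 \<le> A v \<and> A v \<le> c"
    and "m * c + (\<Sum>v\<in>V. A v - 1) < vdeg V e + c"
  shows "e \<in> sumset_power U m"
  using assms(5)
proof (induction m arbitrary: e)
  case (Suc m)
  have "\<exists>v\<in>V. A v \<le> Poly_Mapping.lookup e v"
  proof (rule ccontr)
    assume "\<not> ?thesis"
    then have "vdeg V e \<le> (\<Sum>v\<in>V. A v - 1)"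
      unfolding vdeg_def by (intro sum_mono) force
    then show False using Suc.prems by simp
  qed
  then obtain v where v: "v \<in> V" "A v \<le> Poly_Mapping.lookup e v" by blast
  define d where "d = e - Poly_Mapping.single v (A v)"
  have e: "e = Poly_Mapping.single v (A v) + d"
    using v(2) by (intro poly_mapping_eqI)
      (auto simp: d_def lookup_add lookup_minus lookup_single when_def)
  have "vdeg V e \<le> c + vdeg V d" using v(1) c [of v] V by (simp add: e vdeg_add vdeg_single)
  then have "m * c + (\<Sum>v\<in>V. A v - 1) < vdeg V d + c" using Suc.prems by simp
  from Suc.IH [OF this] show ?case
    unfolding e by (rule sumset_power_SucI [OF assms(1) [OF v(1)]])
qed simp

text \<open>
  Each summand from \<open>U\<close> contributes at least \<open>1\<close> to the sum of the integer quotients, and taking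
  quotients is superadditive.
\<close>
lemma sumset_power_pure:
  assumes "\<And>e. e \<in> U \<Longrightarrow> \<exists>v\<in>V. A v \<le> Poly_Mapping.lookup e v"
    and "finite V" "\<And>v. v \<in> V \<Longrightarrow> 1 \<le> A v"
    and "e \<in> sumset_power U m"
  shows "m \<le> (\<Sum>v\<in>V. Poly_Mapping.lookup e v div A v)"
  using assms(4)
proof (induction m arbitrary: e)
  case (Suc m)
  then obtain x y where e: "e = x + y" "x \<in> U" "y \<in> sumset_power U m" by auto
  obtain w where w: "w \<in> V" "A w \<le> Poly_Mapping.lookup x w" using assms(1) e(2) by blast
  have "1 \<le> Poly_Mapping.lookup x w div A w"
    using w assms(3) [of w] by (simp add: Suc_leI div_greater_zero_iff)
  also have "\<dots> \<le> (\<Sum>v\<in>V. Poly_Mapping.lookup x v div A v)"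
    using w(1) assms(2) by (intro member_le_sum) auto
  finally have "Suc m \<le> (\<Sum>v\<in>V. Poly_Mapping.lookup x v div A v)
      + (\<Sum>v\<in>V. Poly_Mapping.lookup y v div A v)"
    using Suc.IH [OF e(3)] by simp
  also have "\<dots> = (\<Sum>v\<in>V. Poly_Mapping.lookup x v div A v + Poly_Mapping.lookup y v div A v)"
    by (simp add: sum.distrib)
  also have "\<dots> \<le> (\<Sum>v\<in>V. Poly_Mapping.lookup e v div A v)"
  proof (rule sum_mono)
    fix v
    show "Poly_Mapping.lookup x v div A v + Poly_Mapping.lookup y v div A v
        \<le> Poly_Mapping.lookup e v div A v"
      unfolding e lookup_add by (subst div_add1_eq) simp
  qed
  finally show ?case .
qed simp

lemma sumset_power_on_axis:
  assumes "\<And>e. e \<in> U \<Longrightarrow> Poly_Mapping.keys e \<subseteq> {w} \<Longrightarrow> c \<le> Poly_Mapping.lookup e w"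
    and "e \<in> sumset_power U m" and "Poly_Mapping.keys e \<subseteq> {w}"
  shows "m * c \<le> Poly_Mapping.lookup e w"
  using assms(2,3)
proof (induction m arbitrary: e)
  case (Suc m)
  then obtain x y where e: "e = x + y" "x \<in> U" "y \<in> sumset_power U m" by auto
  have "Poly_Mapping.keys x \<subseteq> {w}" "Poly_Mapping.keys y \<subseteq> {w}"
    using Suc.prems(2) by (auto simp: e(1) in_keys_iff lookup_add subset_iff)
  then show ?case using Suc.IH [OF e(3)] assms(1) [OF e(2)] by (simp add: e(1) lookup_add)
qed simp

text \<open>
  For the ideal \<open>P\<close> generated by the variables in \<open>V\<close>, this is the step from \<open>P^c \<subseteq> Q\<close> to
  \<open>P^(m c) \<subseteq> Q^m\<close>.
\<close>
lemma sumset_power_of_large_vdeg: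
  assumes "finite V" and "\<And>e. c \<le> vdeg V e \<Longrightarrow> e \<in> U" and "m * c \<le> vdeg V e"
  shows "e \<in> sumset_power U m"
  using assms(3)
proof (induction m arbitrary: e)
  case (Suc m)
  have "c \<le> vdeg V e" using Suc.prems by simp
  then obtain y d where y: "y ` {1..c} \<subseteq> V"
    and e: "e = (\<Sum>l\<in>{1..c}. Poly_Mapping.single (y l) 1) + d"
    using vdeg_ge_split_units [OF assms(1)] by blast
  have s: "vdeg V (\<Sum>l\<in>{1..c}. Poly_Mapping.single (y l) 1) = c"
    by (rule vdeg_sum_units [OF assms(1) y])
  then have "m * c \<le> vdeg V d" using Suc.prems by (simp add: e vdeg_add)
  then show ?case unfolding e using s by (intro sumset_power_SucI assms(2) Suc.IH) auto
qed simp

section \<open>Primary monomial ideals\<close>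

theorem lemma12:
  fixes Q :: "('n::{finite,linorder}, 'k::field) mpoly set"
    and r t s :: nat
    and i :: "nat \<Rightarrow> 'n"
    and a :: "nat \<Rightarrow> nat"
    and f :: "nat \<Rightarrow> ('n, 'k) mpoly"
  assumes "monomial_ideal Q"
    and "primary_ideal Q"
    and "min_gens Q = {Var (i j) ^ a j | j. j \<in> {1..r}} \<union> f ` {1..t}"
    and "\<And>j. j \<in> {1..r} \<Longrightarrow> 1 \<le> a j"
    and "strict_mono_on {1..r} i"
    and "f ` {1..t} \<subseteq> monomials \<inter> polys_in (i ` {1..r})"
    and "s \<in> {1..r}"
    and "a s = Max (a ` {1..r})"
  shows "(t = 0 \<longrightarrow>
            (\<forall>m\<ge>1. omega (ideal_power Q m) = enat ((m - 1) * a s) + omega Q)) \<and>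
         (omega_linear Q \<longleftrightarrow> omega Q = enat (a s))"
proof -
  define V where "V = i ` {1..r}"
  define A where "A v = a (the_inv_into {1..r} i v)" for v
  define U where "U = {e. (Poly_Mapping.single e 1 :: ('n, 'k) mpoly) \<in> Q}"
  define w where "w = i s"
  define D where "D = (\<Sum>v\<in>V. A v - 1)"
  have "inj_on i {1..r}" using assms(5) by (rule strict_mono_on_imp_inj_on)
  then have A: "A (i j) = a j" if "j \<in> {1..r}" for j
    using that by (simp add: A_def the_inv_into_f_f)
  have w: "w \<in> V" using assms(7) by (simp add: V_def w_def)
  have c: "a s = A w" using A assms(7) by (simp add: w_def)
  have A_bounds: "1 \<le> A v \<and> A v \<le> A w" if "v \<in> V" for v
    using that A assms(4,8) by (auto simp: V_def simp flip: c)
  have Q: "Q = mono_ideal U"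
    unfolding U_def by (rule monomial_ideal_eq_mono_ideal [OF assms(1)])
  have gens: "Poly_Mapping.single (Poly_Mapping.single v (A v)) 1 \<in> min_gens Q" if "v \<in> V" for v
    using that A unfolding assms(3) by (auto simp: V_def Var_power)
  have keys_gens: "Poly_Mapping.keys g \<subseteq> V"
    if g: "Poly_Mapping.single g 1 \<in> min_gens Q" for g
  proof -
    consider j where "j \<in> {1..r}" "(Poly_Mapping.single g 1 :: ('n, 'k) mpoly) = Var (i j) ^ a j"
      | "(Poly_Mapping.single g 1 :: ('n, 'k) mpoly) \<in> f ` {1..t}"
      using g unfolding assms(3) by blast
    then show ?thesis
    proof cases
      case 1
      then show ?thesis by (auto simp: Var_power monomial_eq_iff V_def split: if_splits)
    next
      case 2
      then have "(Poly_Mapping.single g 1 :: ('n, 'k) mpoly) \<in> polys_in V"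
        using assms(6) by (auto simp: V_def)
      then show ?thesis by (simp add: polys_in_def)
    qed
  qed
  \<comment> \<open>A minimal generator involves only the variables in \<open>V\<close>, so it still divides a monomial whose
    other exponents have been lowered.\<close>
  have U: "upper_in V U"
    unfolding upper_in_def
  proof (intro ballI allI impI)
    fix e e' :: "'n \<Rightarrow>\<^sub>0 nat"
    assume "e \<in> U" and le: "\<forall>v\<in>V. Poly_Mapping.lookup e v \<le> Poly_Mapping.lookup e' v"
    then obtain g d where g: "e = g + d" "(Poly_Mapping.single g 1 :: ('n, 'k) mpoly) \<in> min_gens Q"
      unfolding U_def using min_gen_below by blast
    have "Poly_Mapping.lookup g v \<le> Poly_Mapping.lookup e' v" for v
    proof (cases "v \<in> V")
      case True
      then show ?thesis using le add_leD1 by (auto simp: g(1) lookup_add)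
    next
      case False
      then have "v \<notin> Poly_Mapping.keys g" using keys_gens [OF g(2)] by blast
      then show ?thesis by (simp add: in_keys_iff)
    qed
    then have "e' = g + (e' - g)"
      by (intro poly_mapping_eqI) (simp add: lookup_add lookup_minus)
    then have "(Poly_Mapping.single e' 1 :: ('n, 'k) mpoly)
        = Poly_Mapping.single (e' - g) 1 * Poly_Mapping.single g 1"
      by (simp add: mult_single add.commute)
    moreover have "Poly_Mapping.single g 1 \<in> Q" using g(2) by (simp add: min_gens_def)
    ultimately show "e' \<in> U"
      using ideal.subspace_scale assms(2) unfolding U_def primary_ideal_def by fastforce
  qed
  have pure: "Poly_Mapping.single v (A v) \<in> U" if "v \<in> V" for v
    using gens [OF that] by (simp add: U_def min_gens_def)
  \<comment> \<open>By minimality of the generator with exponent \<open>A w\<close>, no smaller power of that variable is in \<open>Q\<close>.\<close>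
  have axis: "A w \<le> Poly_Mapping.lookup e w" if "e \<in> U" "Poly_Mapping.keys e \<subseteq> {w}" for e
  proof (rule ccontr)
    define b where "b = Poly_Mapping.lookup e w"
    assume "\<not> A w \<le> Poly_Mapping.lookup e w"
    then have b: "b < A w" by (simp add: b_def)
    have e: "e = Poly_Mapping.single w b"
      using that(2) by (intro poly_mapping_eqI)
        (auto simp: b_def lookup_single when_def in_keys_iff subset_iff)
    have "(Poly_Mapping.single (Poly_Mapping.single w (A w)) 1 :: ('n, 'k) mpoly)
        = Poly_Mapping.single e 1 * Poly_Mapping.single (Poly_Mapping.single w (A w - b)) 1"
      using b by (simp add: e mult_single flip: single_add)
    then have "(Poly_Mapping.single e 1 :: ('n, 'k) mpoly)
        dvd Poly_Mapping.single (Poly_Mapping.single w (A w)) 1" by (metis dvd_triv_left)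
    moreover have "(Poly_Mapping.single e 1 :: ('n, 'k) mpoly) \<in> monomials \<inter> Q"
      using that(1) by (simp add: U_def monomials_def)
    ultimately have "(Poly_Mapping.single e 1 :: ('n, 'k) mpoly)
        = Poly_Mapping.single (Poly_Mapping.single w (A w)) 1"
      using gens [OF w] by (simp add: min_gens_def)
    then have "e = Poly_Mapping.single w (A w)"
      by (simp add: monomial_eq_iff)
    then show False using b by (metis b_def lookup_single_eq less_irrefl)
  qed

  define N where "N m = nil_index V (sumset_power U m)" for m
  have fin: "finite V" by simp
  have large: "e \<in> sumset_power U m" if "m * A w + D < vdeg V e + A w" for e m
    using sumset_power_ge [OF pure U fin A_bounds] that unfolding D_def by blast
  have large': "e \<in> sumset_power U m" if "m * A w + D + 1 \<le> vdeg V e" for e m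
    using that by (intro large) simp
  have less_N: "vdeg V e < N m" if "e \<notin> sumset_power U m" for e m
    unfolding N_def
    by (rule vdeg_less_nil_index [of "m * A w + D + 1", OF _ that]) (rule large')
  have "1 \<le> A w" using A_bounds [OF w] by simp
  have zero: "0 \<notin> sumset_power U m" if "1 \<le> m" for m
    using sumset_power_on_axis [of U w "A w" 0 m] axis that \<open>1 \<le> A w\<close> by auto
  have omega_power: "omega (ideal_power Q m) = enat (N m)" if "1 \<le> m" for m
    unfolding Q ideal_power_mono_ideal [OF U] N_def
    by (rule omega_mono_ideal [OF upper_in_sumset_power [OF U] large' zero [OF that]])
  have "sumset_power U 1 = U"
    using upper_in_add [OF U] by (force intro: exI [of _ "0 :: 'n \<Rightarrow>\<^sub>0 nat"])
  then have omega_Q: "omega Q = enat (N 1)"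
    using omega_power [of 1] ideal_power_mono_ideal [OF U, of 1, where ?'k = 'k] Q by simp
  have N_upper: "N m \<le> (m - 1) * A w + D + 1" if "1 \<le> m" for m
    unfolding N_def using that by (intro nil_index_le large) (cases m; simp)
  have N_lower: "m * A w \<le> N m" if "1 \<le> m" for m
  proof -
    let ?e = "Poly_Mapping.single w (m * A w - 1)"
    have pos: "1 \<le> m * A w" using that \<open>1 \<le> A w\<close> by simp
    have "?e \<notin> sumset_power U m"
    proof
      assume "?e \<in> sumset_power U m"
      from sumset_power_on_axis [of U w "A w", OF axis this] have "m * A w \<le> m * A w - 1"
        by (auto split: if_splits)
      then show False using pos by linarith
    qed
    then have "vdeg V ?e < N m" by (rule less_N)
    then show ?thesis using w by (simp add: vdeg_single)
  qed
  have "omega (ideal_power Q m) = enat ((m - 1) * a s) + omega Q" if t: "t = 0" and m: "1 \<le> m" for m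
  proof -
    have U_pure: "\<exists>v\<in>V. A v \<le> Poly_Mapping.lookup e v" if e: "e \<in> U" for e
    proof -
      obtain g d where g: "e = g + d" "(Poly_Mapping.single g 1 :: ('n, 'k) mpoly) \<in> min_gens Q"
        using e unfolding U_def using min_gen_below by blast
      then obtain j where j: "j \<in> {1..r}" "(Poly_Mapping.single g 1 :: ('n, 'k) mpoly) = Var (i j) ^ a j"
        using t unfolding assms(3) by auto
      then have "g = Poly_Mapping.single (i j) (a j)"
        by (simp add: Var_power monomial_eq_iff)
      then show ?thesis using j A by (auto simp: g(1) V_def lookup_add intro!: bexI [of _ j])
    qed
    have "N m = (m - 1) * A w + D + 1" if m: "1 \<le> m" for m
    proof (rule antisym [OF N_upper [OF m]])
      \<comment> \<open>Just below the threshold in every coordinate, with \<open>m - 1\<close> further copies of the longest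
        step, this is an exponent of largest degree outside \<open>Q^m\<close>.\<close>
      define u where "u = Poly_Mapping.Abs_poly_mapping
        (\<lambda>v. if v \<in> V then A v - 1 + (if v = w then (m - 1) * A w else 0) else 0)"
      have u: "Poly_Mapping.lookup u v
          = (if v \<in> V then A v - 1 + (if v = w then (m - 1) * A w else 0) else 0)" for v
        unfolding u_def by (subst lookup_Abs_poly_mapping) simp_all
      have "vdeg V u = (\<Sum>v\<in>V. A v - 1 + (if v = w then (m - 1) * A w else 0))"
        unfolding vdeg_def by (rule sum.cong) (simp_all add: u)
      also have "\<dots> = D + (m - 1) * A w" using w by (simp add: sum.distrib D_def)
      finally have deg: "vdeg V u = D + (m - 1) * A w" .
      have "(\<Sum>v\<in>V. Poly_Mapping.lookup u v div A v) = (\<Sum>v\<in>V. if v = w then m - 1 else 0)"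
      proof (rule sum.cong)
        fix v assume "v \<in> V"
        then show "Poly_Mapping.lookup u v div A v = (if v = w then m - 1 else 0)"
        proof (cases "v = w")
          case True
          have "(A w - 1 + (m - 1) * A w) div A w = m - 1"
            using \<open>1 \<le> A w\<close> by (subst div_mult_self1) auto
          then show ?thesis using w by (simp only: u True if_True simp_thms)
        next
          case False
          then show ?thesis using A_bounds [of v] \<open>v \<in> V\<close> by (simp add: u)
        qed
      qed simp
      also have "\<dots> = m - 1" using w by simp
      finally have "u \<notin> sumset_power U m"
        using sumset_power_pure [of U V A u m, OF U_pure fin] A_bounds m by fastforce
      then have "vdeg V u < N m" by (rule less_N)
      then show "(m - 1) * A w + D + 1 \<le> N m" by (simp add: deg)
    qed
    from this [OF m] this [of 1] show ?thesis
      by (simp add: omega_power [OF m] omega_Q c)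
  qed
  moreover have "omega_linear Q \<longleftrightarrow> omega Q = enat (a s)"
  proof
    assume "omega_linear Q"
    then have lin: "N m = m * N 1" if "1 \<le> m" for m
      using that omega_power [OF that] omega_Q by (simp add: omega_linear_def)
    have "N 1 \<le> A w"
    proof (rule ccontr)
      assume "\<not> N 1 \<le> A w"
      \<comment> \<open>At \<open>m = D + 2\<close> an excess of \<open>1\<close> per power already outgrows the constant \<open>D + 1\<close>.\<close>
      then have "(D + 2) * (A w + 1) \<le> (D + 2) * N 1" by (intro mult_left_mono) auto
      also have "\<dots> \<le> (D + 1) * A w + D + 1" using N_upper [of "D + 2"] lin [of "D + 2"] by simp
      finally show False by (simp add: algebra_simps)
    qed
    then show "omega Q = enat (a s)" using N_lower [of 1] by (simp add: omega_Q c)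
  next
    assume "omega Q = enat (a s)"
    then have N1: "nil_index V U = A w"
      using omega_Q c \<open>sumset_power U 1 = U\<close> by (simp add: N_def)
    have "e \<in> U" if "A w \<le> vdeg V e" for e
      using vdeg_ge_nil_index [of _ V U, OF large' [of 1, unfolded \<open>sumset_power U 1 = U\<close>]] N1 that
      by simp
    then have "N m \<le> m * A w" for m
      unfolding N_def by (intro nil_index_le sumset_power_of_large_vdeg [OF fin])
    then have "N m = m * A w" if "1 \<le> m" for m
      using N_lower [OF that] by (simp add: antisym)
    then show "omega_linear Q"
      using omega_power \<open>omega Q = enat (a s)\<close> c by (simp add: omega_linear_def)
  qed
  ultimately show ?thesis by blast
qed

end
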